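(* Let $n \ge m > 1$ be integers and let $A$ be an $n\times n$ matrix with all entries in $\{+1,-1\}$. Let $Z(m,A)$ be the number of zero minors of order $m$ of $A$ and $Y(m,A)$ the number of nonzero minors of order $m$ of $A$. Then $$Y(m,A) \le 4\left(\frac{n}{4}\right)^m\binom{n}{m}$$ and $$Z(m,A) \ge \binom{n}{m}\left\{\binom{n}{m} - 4\left(\frac{n}{4}\right)^m\right\}.$$ Moreover, if $m \le 3$, then equality occurs (in each of these inequalities) if and only if $A$ is a Hadamard matrix.
   Context: A minor of order $m$ of $A$ is the determinant of an $m\times m$ submatrix of $A$, obtained by choosing $m$ of the rows and $m$ of the columns of $A$ (not necessarily consecutive). Minors are counted by the choice of rows and columns, so there are exactly $\binom{n}{m}^2$ minors of order $m$ and $Y(m,A)+Z(m,A)=\binom{n}{m}^2$. A Hadamard matrix of order $n$ is an $n\times n$ matrix $H$ with entries in $\{+1,-1\}$ satisfying $HH^T = nI$. *)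

theory Defs
  imports Complex_Main "Jordan_Normal_Form.Determinant" "Jordan_Normal_Form.DL_Submatrix"
begin

text \<open>Matrix indices are \<open>0, \<dots>, n - 1\<close>. A minor of order \<open>m\<close> is identified with its choice of
  rows and columns, so minors with equal values at different positions are counted separately.\<close>

definition minor_positions :: "nat \<Rightarrow> 'a mat \<Rightarrow> (nat set \<times> nat set) set" where
  "minor_positions m A =
     {(I, J). I \<subseteq> {..<dim_row A} \<and> card I = m \<and> J \<subseteq> {..<dim_col A} \<and> card J = m}"

definition zero_minors :: "nat \<Rightarrow> real mat \<Rightarrow> nat" where
  "zero_minors m A = card {(I, J) \<in> minor_positions m A. det (submatrix A I J) = 0}"

definition nonzero_minors :: "nat \<Rightarrow> real mat \<Rightarrow> nat" where
  "nonzero_minors m A = card {(I, J) \<in> minor_positions m A. det (submatrix A I J) \<noteq> 0}"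

definition hadamard_mat :: "nat \<Rightarrow> real mat \<Rightarrow> bool" where
  "hadamard_mat n H \<longleftrightarrow>
     H \<in> carrier_mat n n \<and> elements_mat H \<subseteq> {1, -1} \<and>
     H * transpose_mat H = real n \<cdot>\<^sub>m 1\<^sub>m n"

end

theory Submission
  imports Defs
begin

text \<open>For a set \<open>I\<close> of \<open>m\<close> rows with submatrix \<open>B\<close>, the Cauchy-Binet formula gives the sum of the
  squares of all minors in these rows as \<open>det (B B\<^sup>T)\<close>, which is at most \<open>n ^ m\<close> by Hadamard's
  inequality. A minor of a sign matrix of order \<open>m\<close> is a multiple of \<open>2 ^ (m - 1)\<close>, so each nonzero
  one contributes at least \<open>4 ^ (m - 1)\<close>; summing over \<open>I\<close> yields the bound. For \<open>m \<le> 3\<close> a minor is at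
  most \<open>m! < 2 \<cdot> 2 ^ (m - 1)\<close> in absolute value, so each nonzero one contributes exactly
  \<open>4 ^ (m - 1)\<close>, and equality means that Hadamard's inequality is an equality for every \<open>I\<close>. As
  \<open>m > 1\<close>, every pair of rows lies in some \<open>I\<close>, so this holds iff all rows are orthogonal.\<close>

section \<open>Submatrices and the increasing enumeration of an index set\<close>

lemma Collect_less_mem: "I \<subseteq> {..<n} \<Longrightarrow> {i. i < n \<and> i \<in> I} = I"
  by auto

lemma submatrix_carrier:
  assumes "A \<in> carrier_mat nr nc" "I \<subseteq> {..<nr}" "J \<subseteq> {..<nc}"
  shows "submatrix A I J \<in> carrier_mat (card I) (card J)"
  by (rule carrier_matI) (simp_all add: dim_submatrix carrier_matD[OF assms(1)]
      Collect_less_mem[OF assms(2)] Collect_less_mem[OF assms(3)])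

lemma submatrix_nth:
  assumes "A \<in> carrier_mat nr nc" "I \<subseteq> {..<nr}" "J \<subseteq> {..<nc}" "i < card I" "j < card J"
  shows "submatrix A I J $$ (i, j) = A $$ (pick I i, pick J j)"
  by (rule submatrix_index) (simp_all add: carrier_matD[OF assms(1)]
      Collect_less_mem[OF assms(2)] Collect_less_mem[OF assms(3)] assms(4,5))

lemma submatrix_rows_carrier:
  assumes "A \<in> carrier_mat nr nc" "I \<subseteq> {..<nr}"
  shows "submatrix A I UNIV \<in> carrier_mat (card I) nc"
  by (rule carrier_matI) (simp_all add: dim_submatrix carrier_matD[OF assms(1)]
      Collect_less_mem[OF assms(2)])

lemma submatrix_rows_nth:
  assumes "A \<in> carrier_mat nr nc" "I \<subseteq> {..<nr}" "i < card I" "j < nc"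
  shows "submatrix A I UNIV $$ (i, j) = A $$ (pick I i, j)"
  by (subst submatrix_index) (simp_all add: carrier_matD[OF assms(1)]
      Collect_less_mem[OF assms(2)] assms(3,4) pick_UNIV)

lemma submatrix_cols_carrier:
  assumes "A \<in> carrier_mat nr nc" "J \<subseteq> {..<nc}"
  shows "submatrix A UNIV J \<in> carrier_mat nr (card J)"
  by (rule carrier_matI) (simp_all add: dim_submatrix carrier_matD[OF assms(1)]
      Collect_less_mem[OF assms(2)])

lemma submatrix_cols_nth:
  assumes "A \<in> carrier_mat nr nc" "J \<subseteq> {..<nc}" "i < nr" "j < card J"
  shows "submatrix A UNIV J $$ (i, j) = A $$ (i, pick J j)"
  by (subst submatrix_index) (simp_all add: carrier_matD[OF assms(1)]
      Collect_less_mem[OF assms(2)] assms(3,4) pick_UNIV)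

lemma pick_less:
  assumes "I \<subseteq> {..<n}" "i < card I"
  shows "pick I i < n"
  using pick_in_set_le[OF assms(2)] assms(1) by auto

lemma pick_inj: "i < card I \<Longrightarrow> j < card I \<Longrightarrow> pick I i = pick I j \<Longrightarrow> i = j"
  by (metis card_pick_le)

text \<open>Makes the rank of an element of \<open>J\<close> a valid position for
  \<open>pick J\<close>, which turns the rank back into the element.\<close>

lemma card_less_card:
  fixes J :: "nat set"
  assumes "finite J" "x \<in> J"
  shows "card {a \<in> J. a < x} < card J"
  using assms by (intro psubset_card_mono) auto

text \<open>Identifies the maximal minors of a row selection, as Cauchy-Binet produces them, with
  minors of \<open>A\<close> itself.\<close>

lemma submatrix_cols_of_rows:
  assumes A: "A \<in> carrier_mat nr nc" and I: "I \<subseteq> {..<nr}" and J: "J \<subseteq> {..<nc}"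
  shows "submatrix (submatrix A I UNIV) UNIV J = submatrix A I J"
proof -
  note B = submatrix_rows_carrier[OF A I]
  show ?thesis
  proof (rule eq_matI)
    fix i j assume "i < dim_row (submatrix A I J)" "j < dim_col (submatrix A I J)"
    then have ij: "i < card I" "j < card J" using submatrix_carrier[OF A I J] by auto
    show "submatrix (submatrix A I UNIV) UNIV J $$ (i, j) = submatrix A I J $$ (i, j)"
      using submatrix_cols_nth[OF B J ij] submatrix_rows_nth[OF A I ij(1) pick_less[OF J ij(2)]]
        submatrix_nth[OF A I J ij] by simp
  qed (use submatrix_cols_carrier[OF B J] submatrix_carrier[OF A I J] in auto)
qed

section \<open>The Cauchy-Binet formula\<close>

text \<open>Maps onto the \<open>m\<close>-set \<open>J\<close> correspond to permutations through the increasing enumeration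
  \<open>pick J\<close>. They are the identity outside \<open>{0..<m}\<close> so as to match \<open>det_linear_rows_sum\<close>.\<close>

lemma sum_onto_eq_sum_permutes:
  fixes g :: "(nat \<Rightarrow> nat) \<Rightarrow> 'a :: comm_monoid_add"
  assumes fJ: "finite J" and cJ: "card J = m"
  shows "sum g {f. f ` {0..<m} = J \<and> (\<forall>i. i \<notin> {0..<m} \<longrightarrow> f i = i)} =
    (\<Sum>p | p permutes {0..<m}. g (\<lambda>i. if i < m then pick J (p i) else i))"
proof -
  let ?F = "{f. f ` {0..<m} = J \<and> (\<forall>i. i \<notin> {0..<m} \<longrightarrow> f i = i)}"
  let ?P = "{p. p permutes {0..<m}}"
  let ?f = "\<lambda>p i. if i < m then pick J (p i) else i"
  \<comment> \<open>Inverse to \<open>?f\<close>: the rank of \<open>f i\<close> in \<open>J\<close>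
    is the position at which \<open>pick J\<close> returns \<open>f i\<close>.\<close>
  let ?p = "\<lambda>f i. if i < m then card {a \<in> J. a < f i} else i"
  have pm: "pick J i \<in> J" if "i < m" for i using pick_in_set_le that cJ by blast
  have cp: "card {a \<in> J. a < pick J i} = i" if "i < m" for i using card_pick_le that cJ by blast
  have pc: "pick J (card {a \<in> J. a < x}) = x" if "x \<in> J" for x using pick_card_in_set that by blast
  have cl: "card {a \<in> J. a < x} < m" if "x \<in> J" for x using card_less_card[OF fJ that] cJ by simp
  have pickJ: "pick J ` {0..<m} = J"
    using pm cl pc by (auto simp: image_iff) (metis atLeast0LessThan lessThan_iff)
  show ?thesis
  proof (rule sum.reindex_bij_witness[where i = ?f and j = ?p])
    fix f assume f: "f \<in> ?F"
    then have fJ': "f i \<in> J" if "i < m" for i using that by auto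
    show "?f (?p f) = f" using f fJ' cl pc by auto
    have inj: "inj_on f {0..<m}"
      using f cJ by (intro eq_card_imp_inj_on) auto
    have inj': "inj_on (?p f) {0..<m}"
    proof (rule inj_onI)
      fix i j assume ij: "i \<in> {0..<m}" "j \<in> {0..<m}" "?p f i = ?p f j"
      then have "card {a \<in> J. a < f i} = card {a \<in> J. a < f j}" by simp
      moreover have "f i \<in> J" "f j \<in> J" using ij fJ' by simp_all
      ultimately have "f i = f j" using pc by metis
      with ij inj show "i = j" by (auto dest: inj_onD)
    qed
    have "?p f ` {0..<m} \<subseteq> {0..<m}" using cl fJ' by auto
    with inj' have "bij_betw (?p f) {0..<m} {0..<m}"
      unfolding bij_betw_def by (intro conjI endo_inj_surj) auto
    then show "?p f \<in> ?P" by (auto intro!: bij_imp_permutes)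
    show "g (?f (?p f)) = g f" using \<open>?f (?p f) = f\<close> by simp
  next
    fix p assume "p \<in> ?P"
    then have p: "p permutes {0..<m}" by simp
    have pl: "p i < m" if "i < m" for i using permutes_in_image[OF p, of i] that by auto
    show "?p (?f p) = p"
      using cp pl permutes_not_in[OF p] by fastforce
    have "?f p ` {0..<m} = pick J ` (p ` {0..<m})" by (auto simp: image_image)
    then show "?f p \<in> ?F" using pickJ permutes_image[OF p] by auto
  qed
qed

text \<open>Multilinearity in the rows of the product expands the determinant over maps from row
  indices to column indices. Maps with a repeated value contribute 0. Those with image
  \<open>J\<close> are permutations up to the enumeration of \<open>J\<close> and add up to the
  product of the two minors at \<open>J\<close>.\<close>

theorem cauchy_binet:
  fixes A B :: "'a :: comm_ring_1 mat"
  assumes A: "A \<in> carrier_mat m N" and B: "B \<in> carrier_mat m N"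
  shows "det (A * transpose_mat B) =
    (\<Sum>J | J \<subseteq> {..<N} \<and> card J = m. det (submatrix A UNIV J) * det (submatrix B UNIV J))"
proof -
  let ?S = "{J. J \<subseteq> {..<N} \<and> card J = m}"
  let ?F = "{f. (\<forall>i\<in>{0..<m}. f i \<in> {0..<N}) \<and> (\<forall>i. i \<notin> {0..<m} \<longrightarrow> f i = i)}"
  let ?R = "\<lambda>f. mat\<^sub>r m m (\<lambda>i. col B (f i))"
  define g where "g f = (\<Prod>i = 0..<m. A $$ (i, f i)) * det (?R f)" for f
  have BT: "transpose_mat B \<in> carrier_mat N m" using B by simp
  have finF: "finite ?F" by (rule finite_bounded_functions) auto
  \<comment> \<open>Row \<open>i\<close> of the product is the combination of the rows of
    \<open>transpose_mat B\<close> with coefficients \<open>A $$ (i, k)\<close>; \<open>f i\<close>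
    is the summand chosen in row \<open>i\<close>.\<close>
  have "det (A * transpose_mat B) =
      (\<Sum>f\<in>?F. det (mat\<^sub>r m m (\<lambda>i. A $$ (i, f i) \<cdot>\<^sub>v row (transpose_mat B) (f i))))"
    unfolding mat_mul_finsum_alt[OF A BT] by (rule det_linear_rows_sum) (use B in auto)
  also have "\<dots> = sum g ?F"
  proof (rule sum.cong[OF refl])
    fix f assume f: "f \<in> ?F"
    have "mat\<^sub>r m m (\<lambda>i. A $$ (i, f i) \<cdot>\<^sub>v row (transpose_mat B) (f i)) =
        mat\<^sub>r m m (\<lambda>i. A $$ (i, f i) \<cdot>\<^sub>v col B (f i))"
      using f B by (intro eq_matI) auto
    then show "det (mat\<^sub>r m m (\<lambda>i. A $$ (i, f i) \<cdot>\<^sub>v row (transpose_mat B) (f i))) = g f"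
      unfolding g_def using B
        det_rows_mul[of "\<lambda>i. col B (f i)" m "\<lambda>i. A $$ (i, f i)"] by auto
  qed
  \<comment> \<open>A repeated value of \<open>f\<close> gives \<open>?R f\<close> two equal
    rows.\<close>
  also have "\<dots> = sum g {f \<in> ?F. inj_on f {0..<m}}"
  proof (rule sum.mono_neutral_right[OF finF])
    show "\<forall>f \<in> ?F - {f \<in> ?F. inj_on f {0..<m}}. g f = 0"
    proof
      fix f assume f: "f \<in> ?F - {f \<in> ?F. inj_on f {0..<m}}"
      then obtain i j where ij: "i < m" "j < m" "i \<noteq> j" "f i = f j"
        by (auto simp: inj_on_def)
      have "det (?R f) = 0"
        by (rule det_identical_rows[of _ m i j]) (use ij B in auto)
      then show "g f = 0" by (simp add: g_def)
    qed
  qed auto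
  also have "\<dots> = (\<Sum>J\<in>?S. sum g {f \<in> {f \<in> ?F. inj_on f {0..<m}}. f ` {0..<m} = J})"
  proof (rule sum.group[symmetric])
    show "finite {f \<in> ?F. inj_on f {0..<m}}" by (rule finite_subset[OF _ finF]) auto
    show "finite ?S" by (rule finite_subset[of _ "Pow {..<N}"]) auto
    show "(\<lambda>f. f ` {0..<m}) ` {f \<in> ?F. inj_on f {0..<m}} \<subseteq> ?S"
      by (auto simp: card_image)
  qed
  also have "\<dots> = (\<Sum>J\<in>?S. det (submatrix A UNIV J) * det (submatrix B UNIV J))"
  proof (rule sum.cong[OF refl])
    fix J assume "J \<in> ?S"
    then have J: "J \<subseteq> {..<N}" and cJ: "card J = m" by auto
    have finJ: "finite J" using J finite_subset by blast
    note AJ = submatrix_cols_carrier[OF A J, unfolded cJ]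
    note BJ = submatrix_cols_carrier[OF B J, unfolded cJ]
    \<comment> \<open>A map from \<open>m\<close> indices onto a set of size \<open>m\<close> is
      automatically injective.\<close>
    have set_eq: "{f \<in> {f \<in> ?F. inj_on f {0..<m}}. f ` {0..<m} = J} =
        {f. f ` {0..<m} = J \<and> (\<forall>i. i \<notin> {0..<m} \<longrightarrow> f i = i)}"
    proof -
      have "inj_on f {0..<m}" if "f ` {0..<m} = J" for f
        using that cJ by (intro eq_card_imp_inj_on) auto
      then show ?thesis using J by auto
    qed
    \<comment> \<open>The rows of \<open>?R\<close> are those of the transposed submatrix of
      \<open>B\<close> permuted by \<open>p\<close>, which yields the sign; together with it, the
      factors from \<open>A\<close> form a Leibniz term.\<close>
    have g_perm: "g (\<lambda>i. if i < m then pick J (p i) else i) =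
        signof p * (\<Prod>i = 0..<m. submatrix A UNIV J $$ (i, p i)) * det (submatrix B UNIV J)"
      if p: "p permutes {0..<m}" for p
    proof -
      let ?f = "\<lambda>i. if i < m then pick J (p i) else i"
      have pl: "p i < m" if "i < m" for i using permutes_in_image[OF p, of i] that by auto
      have "?R ?f = mat m m (\<lambda>(i, j). transpose_mat (submatrix B UNIV J) $$ (p i, j))"
        using pl B BJ J cJ by (intro eq_matI) (auto simp: pick_less submatrix_cols_nth[OF B J])
      moreover have "transpose_mat (submatrix B UNIV J) \<in> carrier_mat m m" using BJ by simp
      ultimately have "det (?R ?f) = signof p * det (submatrix B UNIV J)"
        using det_permute_rows[OF _ p] det_transpose[OF BJ] by metis
      moreover have "(\<Prod>i = 0..<m. A $$ (i, ?f i)) = (\<Prod>i = 0..<m. submatrix A UNIV J $$ (i, p i))"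
        using pl cJ by (intro prod.cong) (auto simp: submatrix_cols_nth[OF A J])
      ultimately show ?thesis by (simp add: g_def)
    qed
    have "sum g {f \<in> {f \<in> ?F. inj_on f {0..<m}}. f ` {0..<m} = J} =
        (\<Sum>p | p permutes {0..<m}. signof p * (\<Prod>i = 0..<m. submatrix A UNIV J $$ (i, p i))
          * det (submatrix B UNIV J))"
      unfolding set_eq sum_onto_eq_sum_permutes[OF finJ cJ] using g_perm by (intro sum.cong) auto
    also have "\<dots> = det (submatrix A UNIV J) * det (submatrix B UNIV J)"
      unfolding det_def'[OF AJ] by (simp add: sum_distrib_right)
    finally show "sum g {f \<in> {f \<in> ?F. inj_on f {0..<m}}. f ` {0..<m} = J} =
      det (submatrix A UNIV J) * det (submatrix B UNIV J)" .
  qed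
  finally show ?thesis .
qed


section \<open>Gram matrices and Hadamard's inequality with its equality case\<close>

lemma gram_index:
  fixes B :: "'a :: comm_semiring_0 mat"
  assumes "B \<in> carrier_mat m N" "i < m" "j < m"
  shows "(B * transpose_mat B) $$ (i, j) = (\<Sum>k<N. B $$ (i, k) * B $$ (j, k))"
  using assms by (simp add: scalar_prod_def lessThan_atLeast0)

text \<open>One Gram-Schmidt step on the first row. If that row is zero, all coefficients are \<open>x / 0 = 0\<close>
  and the step does nothing, so this case needs no separate treatment.\<close>

lemma det_gram_step:
  fixes B :: "real mat"
  assumes B: "B \<in> carrier_mat (Suc m) N"
  defines "G \<equiv> B * transpose_mat B"
  defines "D \<equiv> mat m N (\<lambda>(i, j). B $$ (Suc i, j) - G $$ (Suc i, 0) / G $$ (0, 0) * B $$ (0, j))"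
  shows "det G = G $$ (0, 0) * det (D * transpose_mat D)"
    and "i < m \<Longrightarrow> j < m \<Longrightarrow> (D * transpose_mat D) $$ (i, j) =
      G $$ (Suc i, Suc j) - G $$ (Suc i, 0) * G $$ (Suc j, 0) / G $$ (0, 0)"
proof -
  \<comment> \<open>\<open>C\<close> is \<open>B\<close> with \<open>c i\<close> times the first row
    subtracted from each later row \<open>i\<close>, and \<open>L\<close> undoes this;
    \<open>D\<close> is \<open>C\<close> without its first row.\<close>
  define c where "c i = G $$ (i, 0) / G $$ (0, 0)" for i
  define C where "C = mat (Suc m) N (\<lambda>(i, j). B $$ (i, j) - (if i = 0 then 0 else c i * B $$ (0, j)))"
  define L :: "real mat" where "L = mat (Suc m) (Suc m)
    (\<lambda>(i, j). if i = j then 1 else if j = 0 then c i else 0)"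
  have C: "C \<in> carrier_mat (Suc m) N" and L: "L \<in> carrier_mat (Suc m) (Suc m)"
    and D: "D \<in> carrier_mat m N"
    by (simp_all add: C_def L_def D_def)
  have G: "G $$ (i, j) = (\<Sum>k<N. B $$ (i, k) * B $$ (j, k))" if "i < Suc m" "j < Suc m" for i j
    unfolding G_def using gram_index[OF B that] .
  have G0: "G $$ (i, 0) = 0" if "G $$ (0, 0) = 0" "i < Suc m" for i
  proof -
    have "\<forall>k\<in>{..<N}. B $$ (0, k) * B $$ (0, k) = 0"
      using that(1) G[of 0 0] by (subst sum_nonneg_eq_0_iff[symmetric]) auto
    then show ?thesis using G[OF that(2), of 0] by simp
  qed
  \<comment> \<open>If the first row vanishes, both sides are 0, so the identity survives the
    division by zero in \<open>c\<close>.\<close>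
  have cG: "c i * G $$ (0, 0) = G $$ (i, 0)" if "i < Suc m" for i
    using G0 that by (cases "G $$ (0, 0) = 0") (auto simp: c_def)
  have Cij: "C $$ (i, k) = B $$ (i, k) - (if i = 0 then 0 else c i * B $$ (0, k))"
    if "i < Suc m" "k < N" for i k
    using that by (simp add: C_def)
  have Gsym: "G $$ (0, i) = G $$ (i, 0)" if "i < Suc m" for i
    using G[of 0 i] G[of i 0] that by (simp add: mult.commute)
  \<comment> \<open>With \<open>s\<close> and \<open>t\<close> left free, one expansion serves both
    the unchanged first row (coefficient 0) and the reduced rows.\<close>
  have sumsq: "(\<Sum>k<N. (B $$ (i, k) - s * B $$ (0, k)) * (B $$ (j, k) - t * B $$ (0, k))) =
      G $$ (i, j) - t * G $$ (i, 0) - s * G $$ (j, 0) + s * t * G $$ (0, 0)"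
    if "i < Suc m" "j < Suc m" for i j s t
    using that by (simp add: G sum_subtractf[symmetric] sum.distrib[symmetric] sum_distrib_left
        algebra_simps)
  \<comment> \<open>The case distinctions encode a block form: the corner stays, the rest of the
    first row and column is 0, and the remaining block loses
    \<open>c i * G $$ (j, 0)\<close>.\<close>
  have CC: "(C * transpose_mat C) $$ (i, j) = G $$ (i, j)
      - (if i = 0 \<or> j = 0 then 0 else c i * G $$ (j, 0)) - (if i = 0 \<or> j \<noteq> 0 then 0 else G $$ (i, 0))
      - (if i \<noteq> 0 \<or> j = 0 then 0 else G $$ (0, j))"
    if ij: "i < Suc m" "j < Suc m" for i j
  proof -
    have "(C * transpose_mat C) $$ (i, j) =
        (\<Sum>k<N. (B $$ (i, k) - (if i = 0 then 0 else c i) * B $$ (0, k))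
              * (B $$ (j, k) - (if j = 0 then 0 else c j) * B $$ (0, k)))"
      unfolding gram_index[OF C ij] using ij by (intro sum.cong) (auto simp: Cij)
    also have "\<dots> = G $$ (i, j) - (if j = 0 then 0 else c j) * G $$ (i, 0)
        - (if i = 0 then 0 else c i) * G $$ (j, 0)
        + (if i = 0 then 0 else c i) * (if j = 0 then 0 else c j) * G $$ (0, 0)"
      by (rule sumsq[OF ij])
    finally show ?thesis using cG[OF ij(1)] cG[OF ij(2)] Gsym[OF ij(1)] Gsym[OF ij(2)]
      by (auto simp: mult.assoc c_def)
  qed
  have Dij: "D $$ (i, k) = C $$ (Suc i, k)" if "i < m" "k < N" for i k
    using that by (simp add: D_def C_def c_def)
  have DD: "(D * transpose_mat D) $$ (i, j) = (C * transpose_mat C) $$ (Suc i, Suc j)"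
    if "i < m" "j < m" for i j
    using gram_index[OF D that] gram_index[OF C, of "Suc i" "Suc j"] that Dij by simp
  show "i < m \<Longrightarrow> j < m \<Longrightarrow> (D * transpose_mat D) $$ (i, j) =
      G $$ (Suc i, Suc j) - G $$ (Suc i, 0) * G $$ (Suc j, 0) / G $$ (0, 0)"
    using DD[of i j] CC[of "Suc i" "Suc j"] by (simp add: c_def)
  have "B = L * C"
  proof (rule eq_matI)
    fix i j assume "i < dim_row (L * C)" "j < dim_col (L * C)"
    then have ij: "i < Suc m" "j < N" using L C by auto
    have "(L * C) $$ (i, j) = (\<Sum>k<Suc m. L $$ (i, k) * C $$ (k, j))"
      using L C ij by (simp add: scalar_prod_def lessThan_atLeast0)
    \<comment> \<open>Row \<open>i\<close> of \<open>L\<close> vanishes outside the columns 0 and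
      \<open>i\<close>.\<close>
    also have "\<dots> = (\<Sum>k\<in>{0, i}. L $$ (i, k) * C $$ (k, j))"
      by (rule sum.mono_neutral_right) (use ij in \<open>auto simp: L_def\<close>)
    also have "\<dots> = B $$ (i, j)"
      using ij by (cases "i = 0") (auto simp: L_def Cij)
    finally show "B $$ (i, j) = (L * C) $$ (i, j)" by simp
  qed (use B L C in auto)
  then have "G = L * C * (transpose_mat C * transpose_mat L)"
    unfolding G_def using transpose_mult[OF L C] by simp
  also have "\<dots> = L * (C * (transpose_mat C * transpose_mat L))"
    by (rule assoc_mult_mat) (use L C in auto)
  also have "C * (transpose_mat C * transpose_mat L) = C * transpose_mat C * transpose_mat L"
    by (rule assoc_mult_mat[symmetric]) (use L C in auto)
  also have "L * \<dots> = L * (C * transpose_mat C) * transpose_mat L"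
    by (rule assoc_mult_mat[symmetric]) (use L C in auto)
  finally have "G = L * (C * transpose_mat C) * transpose_mat L" .
  \<comment> \<open>\<open>L\<close> is unit lower triangular, so \<open>B\<close> and
    \<open>C\<close> have the same Gram determinant.\<close>
  moreover have "det L = 1"
  proof -
    have "det L = prod_list (diag_mat L)"
      by (rule det_lower_triangular[OF _ L]) (auto simp: L_def)
    also have "\<dots> = 1"
      unfolding prod_list_diag_prod by (rule prod.neutral) (auto simp: L_def)
    finally show ?thesis .
  qed
  ultimately have "det G = det (C * transpose_mat C)"
    using L C by (simp add: det_mult[of _ "Suc m"] det_transpose[OF L])
  \<comment> \<open>The first row of the Gram matrix of \<open>C\<close> is zero off the corner, so
    only one term of the expansion survives.\<close>
  also have "\<dots> = (\<Sum>j<Suc m. (C * transpose_mat C) $$ (0, j) * cofactor (C * transpose_mat C) 0 j)"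
    by (rule laplace_expansion_row) (use C in auto)
  also have "\<dots> = (\<Sum>j\<in>{0}. (C * transpose_mat C) $$ (0, j) * cofactor (C * transpose_mat C) 0 j)"
  proof (rule sum.mono_neutral_right)
    show "\<forall>j\<in>{..<Suc m} - {0}. (C * transpose_mat C) $$ (0, j) * cofactor (C * transpose_mat C) 0 j = 0"
    proof
      fix j assume "j \<in> {..<Suc m} - {0}"
      then show "(C * transpose_mat C) $$ (0, j) * cofactor (C * transpose_mat C) 0 j = 0"
        using CC[of 0 j] by simp
    qed
  qed auto
  also have "\<dots> = G $$ (0, 0) * det (mat_delete (C * transpose_mat C) 0 0)"
    using CC[of 0 0] by (simp add: cofactor_def)
  also have "mat_delete (C * transpose_mat C) 0 0 = D * transpose_mat D"
  proof (rule eq_matI)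
    fix i j assume "i < dim_row (D * transpose_mat D)" "j < dim_col (D * transpose_mat D)"
    then have ij: "i < m" "j < m" using D by auto
    have "C * transpose_mat C \<in> carrier_mat (Suc m) (Suc m)" using C by simp
    from mat_delete_index[OF this, of 0 0 i j] ij
    show "mat_delete (C * transpose_mat C) 0 0 $$ (i, j) = (D * transpose_mat D) $$ (i, j)"
      using DD[OF ij] by simp
  qed (use C D in auto)
  finally show "det G = G $$ (0, 0) * det (D * transpose_mat D)" .
qed

lemma gram_diag_nonneg:
  fixes B :: "real mat"
  assumes "B \<in> carrier_mat m N" "i < m"
  shows "0 \<le> (B * transpose_mat B) $$ (i, i)"
  unfolding gram_index[OF assms(1,2,2)] by (intro sum_nonneg) simp

text \<open>Induction on the number of rows: a Gram-Schmidt step splits off the squared length of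
  the first row, and removing the components along that row cannot lengthen the others.\<close>

theorem hadamard_inequality:
  fixes B :: "real mat"
  assumes "B \<in> carrier_mat m N"
  shows "det (B * transpose_mat B) \<le> (\<Prod>i<m. (B * transpose_mat B) $$ (i, i))"
  using assms
proof (induction m arbitrary: B)
  case 0
  then have "B * transpose_mat B \<in> carrier_mat 0 0" by simp
  then show ?case by simp
next
  case (Suc m)
  let ?G = "B * transpose_mat B"
  define D where
    "D = mat m N (\<lambda>(i, j). B $$ (Suc i, j) - ?G $$ (Suc i, 0) / ?G $$ (0, 0) * B $$ (0, j))"
  have D: "D \<in> carrier_mat m N" by (simp add: D_def)
  note step = det_gram_step[OF Suc.prems, folded D_def]
  have g: "0 \<le> ?G $$ (0, 0)" using gram_diag_nonneg[OF Suc.prems] by simp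
  have "det ?G = ?G $$ (0, 0) * det (D * transpose_mat D)" by (rule step)
  also have "\<dots> \<le> ?G $$ (0, 0) * (\<Prod>i<m. (D * transpose_mat D) $$ (i, i))"
    by (rule mult_left_mono[OF Suc.IH[OF D] g])
  \<comment> \<open>By \<open>step(2)\<close> each diagonal entry drops by a square divided by
    \<open>?G $$ (0, 0)\<close>, which is nonnegative.\<close>
  also have "\<dots> \<le> ?G $$ (0, 0) * (\<Prod>i<m. ?G $$ (Suc i, Suc i))"
    using gram_diag_nonneg[OF D] g by (intro mult_left_mono prod_mono) (auto simp: step(2))
  also have "\<dots> = (\<Prod>i<Suc m. ?G $$ (i, i))"
    by (simp only: prod.lessThan_Suc_shift)
  finally show ?case .
qed

text \<open>As all squared lengths are positive, any strict loss in a Gram-Schmidt step would show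
  in the product. Equality thus means that no row is shortened, so the first row is orthogonal to
  the others, and the induction hypothesis handles the rest.\<close>

theorem hadamard_inequality_eq_imp_orthogonal:
  fixes B :: "real mat"
  assumes "B \<in> carrier_mat m N"
    and "det (B * transpose_mat B) = (\<Prod>i<m. (B * transpose_mat B) $$ (i, i))"
    and "\<And>i. i < m \<Longrightarrow> 0 < (B * transpose_mat B) $$ (i, i)"
    and "i < m" "j < m" "i \<noteq> j"
  shows "(B * transpose_mat B) $$ (i, j) = 0"
  using assms
proof (induction m arbitrary: B i j)
  case 0
  then show ?case by simp
next
  case (Suc m)
  let ?G = "B * transpose_mat B"
  define D where
    "D = mat m N (\<lambda>(i, j). B $$ (Suc i, j) - ?G $$ (Suc i, 0) / ?G $$ (0, 0) * B $$ (0, j))"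
  let ?H = "D * transpose_mat D"
  have D: "D \<in> carrier_mat m N" by (simp add: D_def)
  note step = det_gram_step[OF Suc.prems(1), folded D_def]
  have pos: "0 < ?G $$ (Suc k, Suc k)" if "k < m" for k
    using Suc.prems(3) that by simp
  have g: "0 < ?G $$ (0, 0)" using Suc.prems(3) by simp
  have le: "?H $$ (k, k) \<le> ?G $$ (Suc k, Suc k)" if "k < m" for k
    using that g by (simp add: step(2))
  have "?G $$ (0, 0) * det ?H = ?G $$ (0, 0) * (\<Prod>k<m. ?G $$ (Suc k, Suc k))"
    using Suc.prems(2) unfolding step(1) by (simp only: prod.lessThan_Suc_shift)
  then have det_eq: "det ?H = (\<Prod>k<m. ?G $$ (Suc k, Suc k))" using g by simp
  \<comment> \<open>A single strict drop would make the diagonal product of \<open>?H\<close>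
    smaller than \<open>det ?H\<close>, against Hadamard's inequality for \<open>D\<close>.\<close>
  have H_diag: "?H $$ (k, k) = ?G $$ (Suc k, Suc k)" if k: "k < m" for k
  proof (rule ccontr)
    assume "?H $$ (k, k) \<noteq> ?G $$ (Suc k, Suc k)"
    then have less: "?H $$ (k, k) < ?G $$ (Suc k, Suc k)" using le[OF k] by simp
    have "(\<Prod>l<m. ?H $$ (l, l)) = ?H $$ (k, k) * (\<Prod>l\<in>{..<m} - {k}. ?H $$ (l, l))"
      using k by (intro prod.remove) auto
    also have "\<dots> \<le> ?H $$ (k, k) * (\<Prod>l\<in>{..<m} - {k}. ?G $$ (Suc l, Suc l))"
      using gram_diag_nonneg[OF D] k le by (intro mult_left_mono prod_mono) auto
    also have "\<dots> < ?G $$ (Suc k, Suc k) * (\<Prod>l\<in>{..<m} - {k}. ?G $$ (Suc l, Suc l))"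
      using less pos by (intro mult_strict_right_mono prod_pos) auto
    also have "\<dots> = (\<Prod>l<m. ?G $$ (Suc l, Suc l))"
      using k by (intro prod.remove[symmetric]) auto
    finally show False using hadamard_inequality[OF D] det_eq by simp
  qed
  \<comment> \<open>The drop is the square of this entry over a positive number, and it is
    0.\<close>
  have G0: "?G $$ (Suc k, 0) = 0" if "k < m" for k
    using H_diag[OF that] g that by (simp add: step(2))
  have G0': "?G $$ (0, Suc k) = 0" if "k < m" for k
    using G0[OF that] that gram_index[OF Suc.prems(1), of 0 "Suc k"]
      gram_index[OF Suc.prems(1), of "Suc k" 0] by (simp add: mult.commute)
  have H0: "?H $$ (k, l) = 0" if "k < m" "l < m" "k \<noteq> l" for k l
  proof (rule Suc.IH[OF D _ _ that])
    show "det ?H = (\<Prod>k<m. ?H $$ (k, k))" using det_eq H_diag by simp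
    show "0 < ?H $$ (k, k)" if "k < m" for k using H_diag[OF that] pos[OF that] by simp
  qed
  show ?case
  proof (cases i)
    case 0
    then show ?thesis using G0' Suc.prems(5,6) by (cases j) auto
  next
    case i: (Suc k)
    show ?thesis
    proof (cases j)
      case 0
      then show ?thesis using G0 Suc.prems(4) i by auto
    next
      case (Suc l)
      then have kl: "k < m" "l < m" "k \<noteq> l" using Suc.prems(4-6) i by auto
      show ?thesis using H0[OF kl] step(2)[OF kl(1,2)] G0[OF kl(1)] i Suc by simp
    qed
  qed
qed

section \<open>Determinants of sign matrices\<close>

lemma det_Ints:
  fixes A :: "real mat"
  assumes "A \<in> carrier_mat n n" "\<And>i j. i < n \<Longrightarrow> j < n \<Longrightarrow> A $$ (i, j) \<in> \<int>"
  shows "det A \<in> \<int>"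
proof -
  have "A $$ (i, p i) \<in> \<int>" if "p permutes {0..<n}" "i < n" for p i
    using assms(2) that permutes_in_image[OF that(1), of i] by auto
  then show ?thesis
    unfolding det_def'[OF assms(1)] by (auto intro!: Ints_sum Ints_mult Ints_prod simp: sign_def)
qed

lemma abs_det_le_fact:
  fixes A :: "real mat"
  assumes "A \<in> carrier_mat n n" "\<And>i j. i < n \<Longrightarrow> j < n \<Longrightarrow> \<bar>A $$ (i, j)\<bar> \<le> 1"
  shows "\<bar>det A\<bar> \<le> fact n"
proof -
  have "\<bar>det A\<bar> \<le> (\<Sum>p | p permutes {0..<n}. \<bar>signof p * (\<Prod>i = 0..<n. A $$ (i, p i))\<bar>)"
    unfolding det_def'[OF assms(1)] by (rule sum_abs)
  also have "\<dots> \<le> (\<Sum>p | p permutes {0..<n}. 1)"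
  proof (rule sum_mono)
    fix p assume "p \<in> {p. p permutes {0..<n}}"
    then have p: "p permutes {0..<n}" by simp
    have "\<bar>A $$ (i, p i)\<bar> \<le> 1" if "i < n" for i
      using assms(2) that permutes_in_image[OF p, of i] by auto
    then have "(\<Prod>i = 0..<n. \<bar>A $$ (i, p i)\<bar>) \<le> 1" by (intro prod_le_1) auto
    then show "\<bar>signof p * (\<Prod>i = 0..<n. A $$ (i, p i))\<bar> \<le> 1"
      by (simp add: abs_mult abs_prod sign_def)
  qed
  also have "\<dots> = fact n"
    using card_permutations[of "{0..<n}" n] by simp
  finally show ?thesis .
qed

text \<open>Subtracting the first row from the others leaves rows with entries in \<open>{0, 2, -2}\<close>.\<close>

lemma det_sign_mat_dvd:
  fixes A :: "real mat"
  assumes A: "A \<in> carrier_mat (Suc m) (Suc m)"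
    and sgn: "\<And>i j. i < Suc m \<Longrightarrow> j < Suc m \<Longrightarrow> A $$ (i, j) \<in> {1, -1}"
  shows "\<exists>d \<in> \<int>. det A = 2 ^ m * d"
proof -
  \<comment> \<open>\<open>D\<close> holds the halved differences to the first row, which are
    integers; \<open>L\<close> doubles them and adds the first row back, so its diagonal is one 1
    and \<open>m\<close> entries 2.\<close>
  define L :: "real mat" where "L = mat (Suc m) (Suc m)
    (\<lambda>(i, j). if j = 0 then 1 else if i = j then 2 else 0)"
  define D where "D = mat (Suc m) (Suc m)
    (\<lambda>(i, j). if i = 0 then A $$ (0, j) else (A $$ (i, j) - A $$ (0, j)) / 2)"
  have L: "L \<in> carrier_mat (Suc m) (Suc m)" and D: "D \<in> carrier_mat (Suc m) (Suc m)"
    by (simp_all add: L_def D_def)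
  have "A = L * D"
  proof (rule eq_matI)
    fix i j assume "i < dim_row (L * D)" "j < dim_col (L * D)"
    then have ij: "i < Suc m" "j < Suc m" using L D by auto
    have "(L * D) $$ (i, j) = (\<Sum>k<Suc m. L $$ (i, k) * D $$ (k, j))"
      using L D ij by (simp add: scalar_prod_def lessThan_atLeast0)
    also have "\<dots> = (\<Sum>k\<in>{0, i}. L $$ (i, k) * D $$ (k, j))"
      by (rule sum.mono_neutral_right) (use ij in \<open>auto simp: L_def\<close>)
    also have "\<dots> = A $$ (i, j)"
      using ij by (cases "i = 0") (auto simp: L_def D_def field_simps)
    finally show "A $$ (i, j) = (L * D) $$ (i, j)" by simp
  qed (use A L D in auto)
  moreover have "det L = 2 ^ m"
  proof -
    have "det L = prod_list (diag_mat L)"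
      by (rule det_lower_triangular[OF _ L]) (auto simp: L_def)
    also have "\<dots> = (\<Prod>i = 0..<Suc m. if i = 0 then 1 else 2)"
      unfolding prod_list_diag_prod by (rule prod.cong) (auto simp: L_def)
    also have "\<dots> = 2 ^ m"
      by (simp add: prod.atLeast0_lessThan_Suc_shift del: prod.op_ivl_Suc)
    finally show ?thesis .
  qed
  moreover have "det D \<in> \<int>"
  proof (rule det_Ints[OF D])
    fix i j assume "i < Suc m" "j < Suc m"
    then show "D $$ (i, j) \<in> \<int>"
      using sgn[of i j] sgn[of 0 j] by (auto simp: D_def)
  qed
  ultimately show ?thesis using det_mult[OF L D] by auto
qed

text \<open>Phrased with a value that depends only on whether the minor vanishes, so that summing
  over all positions compares the count of nonzero minors with the sum of squares.\<close>

lemma det_sign_mat_sq: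
  fixes A :: "real mat"
  assumes A: "A \<in> carrier_mat m m" and m: "0 < m"
    and sgn: "\<And>i j. i < m \<Longrightarrow> j < m \<Longrightarrow> A $$ (i, j) \<in> {1, -1}"
  shows "(if det A = 0 then 0 else 4 ^ (m - 1)) \<le> (det A)\<^sup>2"
    and "m \<le> 3 \<Longrightarrow> (det A)\<^sup>2 = (if det A = 0 then 0 else 4 ^ (m - 1))"
proof -
  obtain k where k: "m = Suc k" using m by (cases m) auto
  obtain z :: int where z: "det A = 2 ^ k * of_int z"
    using det_sign_mat_dvd[of A k] A sgn k by (auto simp: Ints_def)
  have sq: "(det A)\<^sup>2 = 4 ^ k * of_int (z\<^sup>2)"
    by (simp add: z power_mult_distrib power2_eq_square flip: power_mult_distrib)
  have "z \<noteq> 0 \<Longrightarrow> 1 \<le> z\<^sup>2" by (simp add: int_one_le_iff_zero_less)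
  then have "z \<noteq> 0 \<Longrightarrow> 1 \<le> (of_int (z\<^sup>2) :: real)" by linarith
  then show "(if det A = 0 then 0 else 4 ^ (m - 1)) \<le> (det A)\<^sup>2"
    unfolding sq k by (auto simp: z)
  assume "m \<le> 3"
  have "\<bar>det A\<bar> \<le> fact m"
    using sgn by (intro abs_det_le_fact[OF A]) force
  \<comment> \<open>The right side is \<open>2 ^ m\<close>: 1 < 2, 2 < 4 and 6 < 8, whereas 24 > 16
    for order 4.\<close>
  also have "fact m < 2 ^ k * (2 :: real)"
  proof -
    have "k = 0 \<or> k = 1 \<or> k = 2" using \<open>m \<le> 3\<close> k by auto
    then show ?thesis unfolding k by (auto simp: fact_numeral numeral_2_eq_2)
  qed
  finally have "\<bar>of_int z :: real\<bar> < 2" by (simp add: z abs_mult)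
  then have "\<bar>z\<bar> < 2" by linarith
  then have "z = 0 \<or> z\<^sup>2 = 1" by (auto simp: power2_eq_1_iff)
  then show "(det A)\<^sup>2 = (if det A = 0 then 0 else 4 ^ (m - 1))"
    unfolding sq k by (auto simp: z simp del: of_int_power)
qed


section \<open>Counting minors through the Gram matrices of row sets\<close>

lemma gram_submatrix_rows:
  fixes A :: "'a :: comm_semiring_0 mat"
  assumes A: "A \<in> carrier_mat nr nc" and I: "I \<subseteq> {..<nr}" and ij: "i < card I" "j < card I"
  shows "(submatrix A I UNIV * transpose_mat (submatrix A I UNIV)) $$ (i, j) =
    (A * transpose_mat A) $$ (pick I i, pick I j)"
  unfolding gram_index[OF submatrix_rows_carrier[OF A I] ij]
    gram_index[OF A pick_less[OF I ij(1)] pick_less[OF I ij(2)]]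
  using submatrix_rows_nth[OF A I] ij by simp

text \<open>Passes from equality in the total count to equality in Hadamard's inequality for each
  single row set.\<close>

lemma sum_eq_imp_eq_of_le:
  fixes f g :: "'a \<Rightarrow> real"
  assumes "finite S" "\<And>x. x \<in> S \<Longrightarrow> f x \<le> g x" "sum f S = sum g S" "x \<in> S"
  shows "f x = g x"
proof -
  have "(\<Sum>x\<in>S. g x - f x) = 0" using assms(3) by (simp add: sum_subtractf)
  then show ?thesis using assms by (subst (asm) sum_nonneg_eq_0_iff) auto
qed

theorem corollary2:
  fixes n m :: nat and A :: "real mat"
  assumes "1 < m" and "m \<le> n"
    and "A \<in> carrier_mat n n" and "elements_mat A \<subseteq> {1, -1}"
  shows "real (nonzero_minors m A) \<le> 4 * (real n / 4) ^ m * real (n choose m) \<and>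
    real (zero_minors m A)
      \<ge> real (n choose m) * (real (n choose m) - 4 * (real n / 4) ^ m) \<and>
    (m \<le> 3 \<longrightarrow>
      (real (nonzero_minors m A) = 4 * (real n / 4) ^ m * real (n choose m)
        \<longleftrightarrow> hadamard_mat n A) \<and>
      (real (zero_minors m A)
          = real (n choose m) * (real (n choose m) - 4 * (real n / 4) ^ m)
        \<longleftrightarrow> hadamard_mat n A))"
proof -
  note A = assms(3)
  define S where "S = {I. I \<subseteq> {..<n} \<and> card I = m}"
  define P where "P = minor_positions m A"
  define d where "d = (\<lambda>(I, J). det (submatrix A I J))"
  define G where "G I = submatrix A I UNIV * transpose_mat (submatrix A I UNIV)" for I
  have sgn: "A $$ (i, j) \<in> {1, -1}" if "i < n" "j < n" for i j
    using assms(4) elements_matI[OF A that refl] by blast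
  have finS: "finite S" unfolding S_def by (rule finite_subset[of _ "Pow {..<n}"]) auto
  have cardS: "card S = n choose m"
    unfolding S_def using n_subsets[of "{..<n}" m] by simp
  have P: "P = S \<times> S" using A by (auto simp: P_def S_def minor_positions_def)
  have finP: "finite P" using finS by (simp add: P)
  have SD: "I \<subseteq> {..<n}" "card I = m" if "I \<in> S" for I using that by (auto simp: S_def)

  have Y: "nonzero_minors m A = card {x \<in> P. d x \<noteq> 0}"
    unfolding nonzero_minors_def P_def d_def by (rule arg_cong[where f = card]) auto
  have Z: "zero_minors m A = card {x \<in> P. d x = 0}"
    unfolding zero_minors_def P_def d_def by (rule arg_cong[where f = card]) auto
  have "card {x \<in> P. d x = 0} + card {x \<in> P. d x \<noteq> 0} = card ({x \<in> P. d x = 0} \<union> {x \<in> P. d x \<noteq> 0})"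
    using finP by (intro card_Un_disjoint[symmetric]) auto
  also have "{x \<in> P. d x = 0} \<union> {x \<in> P. d x \<noteq> 0} = P" by auto
  also have "card P = (n choose m) * (n choose m)" by (simp add: P card_cartesian_product cardS)
  finally have YZ: "real (zero_minors m A) + real (nonzero_minors m A) =
      real (n choose m) * real (n choose m)"
    unfolding Y Z by (simp flip: of_nat_add of_nat_mult)

  have minor: "submatrix A I J \<in> carrier_mat m m"
    "\<And>i j. i < m \<Longrightarrow> j < m \<Longrightarrow> submatrix A I J $$ (i, j) \<in> {1, -1}"
    if "I \<in> S" "J \<in> S" for I J
  proof -
    show "submatrix A I J \<in> carrier_mat m m"
      using submatrix_carrier[OF A, of I J] SD that by simp
    show "submatrix A I J $$ (i, j) \<in> {1, -1}" if "i < m" "j < m" for i j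
      using submatrix_nth[OF A, of I J i j] SD[OF \<open>I \<in> S\<close>] SD[OF \<open>J \<in> S\<close>] that
        sgn[OF pick_less pick_less, of I i J j] by simp
  qed
  have Y_sum: "4 ^ (m - 1) * real (nonzero_minors m A) = (\<Sum>x\<in>P. if d x = 0 then 0 else 4 ^ (m - 1))"
    unfolding Y using finP by (simp add: sum.If_cases Int_def)
  have d_sq: "(if d x = 0 then 0 else 4 ^ (m - 1)) \<le> (d x)\<^sup>2"
    "m \<le> 3 \<Longrightarrow> (d x)\<^sup>2 = (if d x = 0 then 0 else 4 ^ (m - 1))" if "x \<in> P" for x
  proof -
    obtain I J where x: "x = (I, J)" "I \<in> S" "J \<in> S" using \<open>x \<in> P\<close> by (auto simp: P)
    note sq = det_sign_mat_sq[OF minor(1)[OF x(2,3)] _ minor(2)[OF x(2,3)]]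
    show "(if d x = 0 then 0 else 4 ^ (m - 1)) \<le> (d x)\<^sup>2"
      "m \<le> 3 \<Longrightarrow> (d x)\<^sup>2 = (if d x = 0 then 0 else 4 ^ (m - 1))"
      using sq assms(1) by (simp_all add: d_def x(1))
  qed
  have Y_le: "4 ^ (m - 1) * real (nonzero_minors m A) \<le> (\<Sum>x\<in>P. (d x)\<^sup>2)"
    unfolding Y_sum by (rule sum_mono) (rule d_sq(1))
  have Y_eq: "4 ^ (m - 1) * real (nonzero_minors m A) = (\<Sum>x\<in>P. (d x)\<^sup>2)" if "m \<le> 3"
    unfolding Y_sum by (rule sum.cong[OF refl]) (simp only: d_sq(2) that)

  have rows: "submatrix A I UNIV \<in> carrier_mat m n" if "I \<in> S" for I
    using submatrix_rows_carrier[OF A] SD[OF that] by auto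
  have "(\<Sum>x\<in>P. (d x)\<^sup>2) = (\<Sum>I\<in>S. \<Sum>J\<in>S. (det (submatrix A I J))\<^sup>2)"
    unfolding P d_def by (simp add: sum.cartesian_product case_prod_unfold)
  also have "\<dots> = (\<Sum>I\<in>S. det (G I))"
  proof (rule sum.cong[OF refl])
    fix I assume I: "I \<in> S"
    show "(\<Sum>J\<in>S. (det (submatrix A I J))\<^sup>2) = det (G I)"
      unfolding G_def cauchy_binet[OF rows[OF I] rows[OF I]] S_def
      using submatrix_cols_of_rows[OF A SD(1)[OF I]]
      by (intro sum.cong) (auto simp: power2_eq_square)
  qed
  finally have sum_sq: "(\<Sum>x\<in>P. (d x)\<^sup>2) = (\<Sum>I\<in>S. det (G I))" .

  have G_nth: "G I $$ (i, j) = (A * transpose_mat A) $$ (pick I i, pick I j)"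
    if "I \<in> S" "i < m" "j < m" for I i j
    unfolding G_def using gram_submatrix_rows[OF A] SD[OF that(1)] that(2,3) by simp
  have diag: "(A * transpose_mat A) $$ (i, i) = real n" if "i < n" for i
  proof -
    have "A $$ (i, k) * A $$ (i, k) = 1" if "k < n" for k
      using sgn[OF \<open>i < n\<close> that] by auto
    then show ?thesis unfolding gram_index[OF A that that] by simp
  qed
  have G_diag: "G I $$ (i, i) = real n" if "I \<in> S" "i < m" for I i
    using G_nth[OF that that(2)] diag[OF pick_less[of I n i]] SD[OF that(1)] that(2) by simp
  have G_le: "det (G I) \<le> real n ^ m" if "I \<in> S" for I
    using hadamard_inequality[OF rows[OF that]] G_diag[OF that] by (simp add: G_def)
  have const: "(\<Sum>I\<in>S. real n ^ m) = real n ^ m * real (n choose m)" by (simp add: cardS)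
  \<comment> \<open>The leading 4 of the bound completes \<open>4 ^ (m - 1)\<close> to
    \<open>4 ^ m\<close>, which cancels the denominator.\<close>
  have scale: "4 ^ (m - 1) * (4 * (real n / 4) ^ m * real (n choose m)) = real n ^ m * real (n choose m)"
    using assms(1) by (cases m) (auto simp: power_divide)

  have "4 ^ (m - 1) * real (nonzero_minors m A) \<le>
      4 ^ (m - 1) * (4 * (real n / 4) ^ m * real (n choose m))"
    unfolding scale const[symmetric] using Y_le sum_sq sum_mono[OF G_le, of S "\<lambda>x. x"] by simp
  then have bound: "real (nonzero_minors m A) \<le> 4 * (real n / 4) ^ m * real (n choose m)"
    by simp

  \<comment> \<open>The diagonal of \<open>A * transpose_mat A\<close> is \<open>n\<close> for every
    sign matrix, so only orthogonality of distinct rows remains.\<close>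
  have hadamard: "hadamard_mat n A \<longleftrightarrow> (\<forall>i<n. \<forall>j<n. i \<noteq> j \<longrightarrow> (A * transpose_mat A) $$ (i, j) = 0)"
  proof
    assume "hadamard_mat n A"
    then have "A * transpose_mat A = real n \<cdot>\<^sub>m 1\<^sub>m n" by (simp add: hadamard_mat_def)
    then show "\<forall>i<n. \<forall>j<n. i \<noteq> j \<longrightarrow> (A * transpose_mat A) $$ (i, j) = 0" by simp
  next
    assume orth: "\<forall>i<n. \<forall>j<n. i \<noteq> j \<longrightarrow> (A * transpose_mat A) $$ (i, j) = 0"
    have "A * transpose_mat A = real n \<cdot>\<^sub>m 1\<^sub>m n"
    proof (rule eq_matI)
      fix i j assume "i < dim_row (real n \<cdot>\<^sub>m 1\<^sub>m n)" "j < dim_col (real n \<cdot>\<^sub>m 1\<^sub>m n)"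
      then have ij: "i < n" "j < n" by auto
      then show "(A * transpose_mat A) $$ (i, j) = (real n \<cdot>\<^sub>m 1\<^sub>m n) $$ (i, j)"
        using orth diag by (cases "i = j") (simp_all del: index_mult_mat)
    qed (use A in auto)
    then show "hadamard_mat n A" using A assms(4) by (simp add: hadamard_mat_def)
  qed

  have eq_iff: "real (nonzero_minors m A) = 4 * (real n / 4) ^ m * real (n choose m)
      \<longleftrightarrow> hadamard_mat n A" if m3: "m \<le> 3"
  proof -
    have "real (nonzero_minors m A) = 4 * (real n / 4) ^ m * real (n choose m) \<longleftrightarrow>
        4 ^ (m - 1) * real (nonzero_minors m A) =
        4 ^ (m - 1) * (4 * (real n / 4) ^ m * real (n choose m))"
      by simp
    also have "\<dots> \<longleftrightarrow> (\<Sum>I\<in>S. det (G I)) = (\<Sum>I\<in>S. real n ^ m)"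
      unfolding scale const Y_eq[OF m3] sum_sq ..
    also have "\<dots> \<longleftrightarrow> hadamard_mat n A"
      unfolding hadamard
    proof (intro iffI allI impI)
      assume eq: "(\<Sum>I\<in>S. det (G I)) = (\<Sum>I\<in>S. real n ^ m)"
      fix i j assume ij: "i < n" "j < n" "i \<noteq> j"
      obtain I where I: "{i, j} \<subseteq> I" "I \<subseteq> {..<n}" "card I = m"
        using exists_subset_between[of "{i, j}" m "{..<n}"] ij assms(1,2) by auto
      then have IS: "I \<in> S" by (simp add: S_def)
      have finI: "finite I" using I(2) finite_subset by blast
      \<comment> \<open>The positions of the rows \<open>i\<close> and \<open>j\<close> within the
        selection \<open>I\<close>.\<close>
      define i' j' where "i' = card {a \<in> I. a < i}" and "j' = card {a \<in> I. a < j}"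
      have ij': "i' < m" "j' < m" "pick I i' = i" "pick I j' = j"
        using card_less_card[OF finI] I pick_card_in_set by (auto simp: i'_def j'_def)
      have "det (G I) = real n ^ m"
        by (rule sum_eq_imp_eq_of_le[OF finS G_le eq IS])
      then have "G I $$ (i', j') = 0"
        unfolding G_def using G_diag[OF IS] assms(1,2) ij ij'
        by (intro hadamard_inequality_eq_imp_orthogonal[OF rows[OF IS]]) (auto simp: G_def)
      then show "(A * transpose_mat A) $$ (i, j) = 0"
        using G_nth[OF IS ij'(1,2)] ij'(3,4) by simp
    next
      assume orth: "\<forall>i<n. \<forall>j<n. i \<noteq> j \<longrightarrow> (A * transpose_mat A) $$ (i, j) = 0"
      have "det (G I) = real n ^ m" if I: "I \<in> S" for I
      proof -
        \<comment> \<open>Distinct positions pick distinct, hence orthogonal, rows.\<close>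
        have "G I = real n \<cdot>\<^sub>m 1\<^sub>m m"
        proof (rule eq_matI)
          fix i j assume "i < dim_row (real n \<cdot>\<^sub>m 1\<^sub>m m)" "j < dim_col (real n \<cdot>\<^sub>m 1\<^sub>m m)"
          then have ij: "i < m" "j < m" by auto
          then have "pick I i < n" "pick I j < n" "i \<noteq> j \<Longrightarrow> pick I i \<noteq> pick I j"
            using pick_less pick_inj SD[OF I] by blast+
          then show "G I $$ (i, j) = (real n \<cdot>\<^sub>m 1\<^sub>m m) $$ (i, j)"
            using G_nth[OF I ij] G_diag[OF I] orth ij by (cases "i = j") (simp_all del: index_mult_mat)
        qed (use rows[OF I] in \<open>auto simp: G_def\<close>)
        then show ?thesis by simp
      qed
      then show "(\<Sum>I\<in>S. det (G I)) = (\<Sum>I\<in>S. real n ^ m)" by simp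
    qed
    finally show ?thesis .
  qed
  \<comment> \<open>Both counts add up to a constant, so the claims on zero minors restate those on
    nonzero minors.\<close>
  have Z_eq: "real (zero_minors m A) =
      real (n choose m) * real (n choose m) - real (nonzero_minors m A)"
    using YZ by simp
  show ?thesis
    using bound eq_iff unfolding Z_eq by (auto simp: algebra_simps)
qed

end
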